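(* Let $q$ be a prime power, let $F$ be the field with $q^2$ elements, and let $V, W$ be finite-dimensional $F$-vector spaces, each equipped with a nondegenerate Hermitian form. Let $T: V \to W$ be an $F$-linear transformation, with adjoint $T^*: W \to V$. Then there are canonical decompositions $V = V_0 \perp V_1$ and $W = W_0 \perp W_1$ such that (1) $\dim V_0 = \dim W_0$, $T V_0 = W_0$, $T^* W_0 = V_0$ (so $T^*T$ is bijective on $V_0$); (2) $T V_1 \subset W_1$, $T^* W_1 \subset V_1$, and $T^*T$ is nilpotent on $V_1$.
   Context: Hermitian forms over $F=\mathbb{F}_{q^2}$ are taken with respect to the involution $x \mapsto x^q$ of $F$. The adjoint $T^*: W \to V$ of $T$ is the linear map defined by $(Tv, w) = (v, T^*w)$ for all $v \in V$, $w \in W$, where the first form is the one on $W$ and the second is the one on $V$. The notation $V = V_0 \perp V_1$ means that $V$ is the direct sum of the mutually orthogonal subspaces $V_0$ and $V_1$, and similarly for $W = W_0 \perp W_1$. The symbol $\subset$ denotes containment, with equality allowed. *)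

theory Defs
  imports "HOL-Analysis.Analysis" "HOL-Number_Theory.Prime_Powers"
begin

(* Hermitian forms with respect to the involution x |-> x^q, linear in the first argument.
   When the scalar field has q^2 elements, x |-> x^q is a field automorphism, so additivity
   and conjugate-linearity in the second argument follow from the two conditions below. *)
definition hermitian_form ::
  "nat \<Rightarrow> ('f::field \<Rightarrow> 'v::ab_group_add \<Rightarrow> 'v) \<Rightarrow> ('v \<Rightarrow> 'v \<Rightarrow> 'f) \<Rightarrow> bool" where
  "hermitian_form q s h \<longleftrightarrow>
     (\<forall>v. Vector_Spaces.linear s (*) (\<lambda>u. h u v)) \<and> (\<forall>u v. h v u = (h u v) ^ q)"

definition nondegenerate_form :: "('v::zero \<Rightarrow> 'v \<Rightarrow> 'f::zero) \<Rightarrow> bool" where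
  "nondegenerate_form h \<longleftrightarrow> (\<forall>u. (\<forall>v. h u v = 0) \<longrightarrow> u = 0)"

(* The definite description is meaningful when hV is nondegenerate and V is
   finite-dimensional: then the adjoint exists and is unique. *)
definition form_adjoint ::
  "('f::field \<Rightarrow> 'v::ab_group_add \<Rightarrow> 'v) \<Rightarrow> ('v \<Rightarrow> 'v \<Rightarrow> 'f) \<Rightarrow>
   ('f \<Rightarrow> 'w::ab_group_add \<Rightarrow> 'w) \<Rightarrow> ('w \<Rightarrow> 'w \<Rightarrow> 'f) \<Rightarrow> ('v \<Rightarrow> 'w) \<Rightarrow> ('w \<Rightarrow> 'v)" where
  "form_adjoint sV hV sW hW T =
     (THE T'. Vector_Spaces.linear sW sV T' \<and> (\<forall>v w. hW (T v) w = hV v (T' w)))"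

definition orthogonal_direct_sum ::
  "('f::field \<Rightarrow> 'v::ab_group_add \<Rightarrow> 'v) \<Rightarrow> ('v \<Rightarrow> 'v \<Rightarrow> 'f) \<Rightarrow> 'v set \<Rightarrow> 'v set \<Rightarrow> bool" where
  "orthogonal_direct_sum s h V0 V1 \<longleftrightarrow>
     module.subspace s V0 \<and> module.subspace s V1 \<and>
     V0 \<inter> V1 = {0} \<and> {x + y |x y. x \<in> V0 \<and> y \<in> V1} = UNIV \<and>
     (\<forall>x\<in>V0. \<forall>y\<in>V1. h x y = 0)"

definition nilpotent_on :: "('v::zero \<Rightarrow> 'v) \<Rightarrow> 'v set \<Rightarrow> bool" where
  "nilpotent_on N U \<longleftrightarrow> N ` U \<subseteq> U \<and> (\<exists>n. \<forall>u\<in>U. (N ^^ n) u = 0)"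

end

theory Submission
  imports Defs "HOL-Number_Theory.Residues"
begin

text \<open>
  This is a Fitting decomposition. Put \<open>N = T\<^sup>* T\<close> and \<open>M = T T\<^sup>*\<close>. Since \<open>V\<close> and \<open>W\<close> are finite
  sets, some positive power \<open>e\<close> of \<open>N\<close> and some positive power \<open>f\<close> of \<open>M\<close> are idempotent
  (\<open>idempotent_funpow_exists\<close>), and the exponent can be taken to be the same for both. As \<open>N\<close> is
  self-adjoint, so is \<open>e\<close>, and a self-adjoint idempotent splits the space into the orthogonal sum
  of its range and its kernel (\<open>orthogonal_direct_sum_idempotent\<close>). Hence \<open>V\<^sub>0 = range e\<close>,
  \<open>V\<^sub>1 = ker e\<close>, \<open>W\<^sub>0 = range f\<close>, \<open>W\<^sub>1 = ker f\<close> are orthogonal decompositions. The intertwining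
  relations \<open>T e = f T\<close> and \<open>T\<^sup>* f = e T\<^sup>*\<close> (\<open>funpow_comp_intertwine\<close>) show that \<open>T\<close> and \<open>T\<^sup>*\<close>
  respect them. On the range of \<open>e\<close> some positive power of \<open>N\<close> is the identity, so \<open>N\<close>
  is bijective there; on the kernel of \<open>e\<close> that power vanishes, so \<open>N\<close> is nilpotent there.

  The decomposition is canonical in the strong sense of being unique
  (\<open>fitting_decomposition_unique\<close>): a subspace that \<open>N\<close> maps onto itself lies in the range of
  every power of \<open>N\<close>, and one on which \<open>N\<close> is nilpotent is killed by every idempotent positive
  power; two complementary such subspaces must therefore fill the range and the kernel of \<open>e\<close>.

  The adjoint is obtained by counting: for a basis \<open>B\<close>, the map that sends \<open>u\<close> to the values
  \<open>h b u\<close>, \<open>b \<in> B\<close>, is injective by nondegeneracy, and its domain has at least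
  as many elements as the set of all functions from \<open>B\<close> to \<open>F\<close>, so it is onto
  (\<open>nondegenerate_hermitian_represents\<close>). Linearity of the adjoint needs the Frobenius identity
  \<open>(x + y)\<^sup>q = x\<^sup>q + y\<^sup>q\<close>, which holds because \<open>q\<close> is a power of the characteristic.
\<close>

section \<open>Hermitian forms over a finite field\<close>

text \<open>The characteristic is a prime dividing the order \<open>q\<^sup>2\<close> of the field, hence the prime of
  which \<open>q\<close> is a power, so the map is an iterate of the Frobenius endomorphism.\<close>

lemma power_add_finite_field:
  fixes x y :: "'f::field"
  assumes "primepow q" and "CARD('f) = q\<^sup>2"
  shows "(x + y) ^ q = x ^ q + y ^ q"
proof -
  obtain p k where p: "prime p" "k > 0" "q = p ^ k"
    using assms(1) by (auto simp: primepow_def)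
  have "finite (UNIV :: 'f set)"
    using assms p by (intro card_ge_0_finite) (simp add: prime_gt_0_nat)
  then have "prime CHAR('f)"
    by (intro prime_CHAR_semidom finite_imp_CHAR_pos)
  moreover have "CHAR('f) dvd p ^ (k * 2)"
    using CHAR_dvd_CARD[where ?'a = 'f] assms(2) p(3) by (simp add: power_mult)
  ultimately have "CHAR('f) = p"
    using p(1) prime_dvd_power primes_dvd_imp_eq by blast
  with \<open>prime CHAR('f)\<close> p(3) show ?thesis
    by (intro freshmans_dream'[where n = k]) auto
qed

context
  fixes q :: nat
    and s :: "'f::field \<Rightarrow> 'v::ab_group_add \<Rightarrow> 'v"
    and h :: "'v \<Rightarrow> 'v \<Rightarrow> 'f"
  assumes herm: "hermitian_form q s h"
begin

lemma hermitian_form_linear: "Vector_Spaces.linear s (*) (\<lambda>u. h u v)"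
  using herm unfolding hermitian_form_def by blast

lemma hermitian_form_conj: "h v u = h u v ^ q"
  using herm unfolding hermitian_form_def by blast

lemma hermitian_form_module_hom: "module_hom s (*) (\<lambda>u. h u v)"
  using hermitian_form_linear by (rule Vector_Spaces.linear.axioms(3))

lemma hermitian_form_add_left: "h (u + u') v = h u v + h u' v"
  using module_hom.add[OF hermitian_form_module_hom] by fast

lemma hermitian_form_diff_left: "h (u - u') v = h u v - h u' v"
  using module_hom.diff[OF hermitian_form_module_hom] by fast

lemma hermitian_form_scale_left: "h (s c u) v = c * h u v"
  using module_hom.scale[OF hermitian_form_module_hom] by fast

lemma hermitian_form_zero_left: "h 0 v = 0"
  using module_hom.zero[OF hermitian_form_module_hom] by fast

lemma hermitian_form_scale_right: "h v (s c u) = c ^ q * h v u"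
  by (metis hermitian_form_conj hermitian_form_scale_left power_mult_distrib)

lemma hermitian_form_zero_right:
  assumes "q > 0"
  shows "h v 0 = 0"
  using hermitian_form_conj[of v 0] hermitian_form_zero_left[of v] assms by simp

lemma hermitian_form_add_right:
  assumes "\<And>x y :: 'f. (x + y) ^ q = x ^ q + y ^ q"
  shows "h v (u + u') = h v u + h v u'"
  by (metis assms hermitian_form_conj hermitian_form_add_left)

lemma hermitian_form_eqI:
  assumes "nondegenerate_form h" and "\<And>v. h v u = h v u'"
  shows "u = u'"
proof -
  have "h (u - u') v = 0" for v
    using assms(2)[of v] hermitian_form_conj[of u v] hermitian_form_conj[of u' v]
    by (simp only: hermitian_form_diff_left diff_self)
  then show ?thesis
    using assms(1) unfolding nondegenerate_form_def by fastforce
qed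

text \<open>A vector is determined by the values \<open>h b u\<close> on a basis, and there are at least as many
  vectors as families of such values, because independence makes the linear combinations of the
  basis distinct. Thus every family of values, hence every linear functional, is attained; the
  injection into a finite set of functions also shows that the space is finite.\<close>

lemma nondegenerate_hermitian_represents:
  assumes fin: "finite (UNIV :: 'f set)"
    and fd: "finite_dimensional_vector_space s B"
    and nondeg: "nondegenerate_form h"
  shows "finite (UNIV :: 'v set)"
    and "Vector_Spaces.linear s (*) \<phi> \<Longrightarrow> \<exists>u. \<forall>v. h v u = \<phi> v"
proof -
  interpret finite_dimensional_vector_space s B by (rule fd)
  interpret F: vector_space "(*) :: 'f \<Rightarrow> 'f \<Rightarrow> 'f"
    using hermitian_form_linear by (rule Vector_Spaces.linear.axioms(2))
  interpret P: vector_space_pair s "(*) :: 'f \<Rightarrow> 'f \<Rightarrow> 'f" ..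
  define E where "E = (\<lambda>u. restrict (\<lambda>b. h b u) B)"
  define X where "X = (B \<rightarrow>\<^sub>E (UNIV :: 'f set))"
  have finX: "finite X"
    unfolding X_def using finite_Basis fin by (intro finite_PiE) auto
  have E_X: "range E \<subseteq> X"
    by (auto simp: E_def X_def)
  have agree: "h v u = \<psi> v"
    if "Vector_Spaces.linear s (*) \<psi>" and "\<And>b. b \<in> B \<Longrightarrow> h b u = \<psi> b" for u v \<psi>
    using P.linear_eq_on_span[OF hermitian_form_linear that(1,2), of B] span_Basis by auto
  have inj_E: "inj E"
  proof (rule injI)
    fix u u' assume "E u = E u'"
    then have "h b u = h b u'" if "b \<in> B" for b
      using that by (metis E_def restrict_apply')
    then have "h v u = h v u'" for v
      by (rule agree[OF hermitian_form_linear])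
    then show "u = u'"
      by (rule hermitian_form_eqI[OF nondeg])
  qed
  show finV: "finite (UNIV :: 'v set)"
    using finite_imageD[of E UNIV] finite_subset[OF E_X finX] inj_E by blast
  have "inj_on (\<lambda>c. \<Sum>b\<in>B. s (c b) b) X"
  proof (rule inj_onI)
    fix c d assume "c \<in> X" "d \<in> X" and eq: "(\<Sum>b\<in>B. s (c b) b) = (\<Sum>b\<in>B. s (d b) b)"
    have "(\<Sum>b\<in>B. s (c b - d b) b) = 0"
      using eq by (simp add: scale_left_diff_distrib sum_subtractf)
    then have "c b = d b" if "b \<in> B" for b
      using independentD[OF independent_Basis finite_Basis subset_refl, of "\<lambda>b. c b - d b"] that
      by simp
    with \<open>c \<in> X\<close> \<open>d \<in> X\<close> show "c = d"
      unfolding X_def by (intro PiE_ext)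
  qed
  then have "card X \<le> card (UNIV :: 'v set)"
    using finV by (intro card_inj_on_le) auto
  also have "\<dots> = card (range E)"
    by (rule card_image[OF inj_E, symmetric])
  finally have onto: "range E = X"
    by (intro card_seteq finX E_X)
  show "\<exists>u. \<forall>v. h v u = \<phi> v" if \<phi>: "Vector_Spaces.linear s (*) \<phi>"
  proof -
    have "restrict \<phi> B \<in> range E"
      unfolding onto X_def by simp
    then obtain u where "E u = restrict \<phi> B"
      by auto
    then have "h b u = \<phi> b" if "b \<in> B" for b
      using that by (metis E_def restrict_apply')
    then show ?thesis
      using agree[OF \<phi>] by blast
  qed
qed

end

text \<open>Representing the functionals \<open>v \<mapsto> hW (T v) w\<close> gives the adjoint pointwise. It is additive and
  homogeneous, not just semilinear, since both forms are conjugate-linear in the second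
  argument for the same involution; nondegeneracy makes it unique.\<close>

lemma form_adjoint_linear_adjoint:
  fixes q :: nat
    and sV :: "'f::field \<Rightarrow> 'v::ab_group_add \<Rightarrow> 'v"
    and sW :: "'f \<Rightarrow> 'w::ab_group_add \<Rightarrow> 'w"
  assumes q: "primepow q" "CARD('f) = q\<^sup>2"
    and fdV: "finite_dimensional_vector_space sV B"
    and V: "hermitian_form q sV hV" "nondegenerate_form hV"
    and W: "hermitian_form q sW hW"
    and T: "Vector_Spaces.linear sV sW T"
  shows "Vector_Spaces.linear sW sV (form_adjoint sV hV sW hW T)"
    and "hW (T v) w = hV v (form_adjoint sV hV sW hW T w)"
proof -
  interpret T: Vector_Spaces.linear sV sW T by (rule T)
  have fin: "finite (UNIV :: 'f set)"
    using q by (intro card_ge_0_finite) (simp add: primepow_gt_0_nat)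
  note add_q = power_add_finite_field[OF q]
  have "\<exists>u. \<forall>v. hV v u = hW (T v) w" for w
  proof (rule nondegenerate_hermitian_represents(2)[OF V(1) fin fdV V(2)])
    have "Vector_Spaces.linear sV (*) ((\<lambda>u. hW u w) \<circ> T)"
      by (rule Vector_Spaces.linear_compose[OF T hermitian_form_linear[OF W]])
    then show "Vector_Spaces.linear sV (*) (\<lambda>v. hW (T v) w)"
      by (simp add: comp_def)
  qed
  then obtain R where R: "\<And>v w. hV v (R w) = hW (T v) w"
    by metis
  have "Vector_Spaces.linear sW sV R"
  proof (unfold_locales; rule hermitian_form_eqI[OF V])
    show "hV v (R (w + w')) = hV v (R w + R w')" for v w w'
      by (simp add: R hermitian_form_add_right[OF V(1) add_q] hermitian_form_add_right[OF W add_q])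
    show "hV v (R (sW c w)) = hV v (sV c (R w))" for v c w
      by (simp add: R hermitian_form_scale_right[OF V(1)] hermitian_form_scale_right[OF W])
  qed
  with R have "Vector_Spaces.linear sW sV R \<and> (\<forall>v w. hW (T v) w = hV v (R w))"
    by simp
  moreover have "R' = R"
    if "Vector_Spaces.linear sW sV R' \<and> (\<forall>v w. hW (T v) w = hV v (R' w))" for R'
    using that R by (intro ext hermitian_form_eqI[OF V]) metis
  ultimately have
    "Vector_Spaces.linear sW sV (form_adjoint sV hV sW hW T) \<and>
     (\<forall>v w. hW (T v) w = hV v (form_adjoint sV hV sW hW T w))"
    unfolding form_adjoint_def by (rule theI)
  then show "Vector_Spaces.linear sW sV (form_adjoint sV hV sW hW T)"
    and "hW (T v) w = hV v (form_adjoint sV hV sW hW T w)"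
    by blast+
qed

section \<open>Iterates of a self-map\<close>

lemma funpow_comp_intertwine: "S (((R \<circ> S) ^^ n) x) = ((S \<circ> R) ^^ n) (S x)"
  by (induction n) simp_all

lemma funpow_linear:
  assumes "Vector_Spaces.linear s s N"
  shows "Vector_Spaces.linear s s (N ^^ n)"
proof -
  interpret Vector_Spaces.linear s s N by (rule assms)
  show ?thesis
    by (unfold_locales; induction n) (simp_all add: add scale)
qed

lemma funpow_self_adjoint:
  assumes "\<And>u v. h (N u) v = h u (N v)"
  shows "h ((N ^^ n) u) v = h u ((N ^^ n) v)"
  by (induction n arbitrary: u v) (simp_all add: assms funpow_swap1)

lemma funpow_image_invariant:
  assumes "N ` U = U"
  shows "(N ^^ n) ` U = U"
  by (induction n) (simp, metis assms funpow.simps(2) image_comp)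

lemma idempotent_funpow_mult:
  assumes "(f ^^ n) \<circ> (f ^^ n) = f ^^ n" and "m > 0"
  shows "f ^^ (n * m) = f ^^ n"
  using assms(2)
proof (induction m rule: nat_induct_non_zero)
  case (Suc m)
  then show ?case
    using assms(1) by (simp add: funpow_add)
qed simp

text \<open>By pigeonhole the iterates of \<open>f\<close> become periodic, say with period \<open>p\<close> from exponent \<open>i\<close>
  on. Any positive multiple of \<open>p\<close> that is at least \<open>i\<close> is then an exponent with idempotent
  iterate.\<close>

lemma idempotent_funpow_exists:
  fixes f :: "'a \<Rightarrow> 'a"
  assumes "finite (UNIV :: 'a set)"
  shows "\<exists>n>0. (f ^^ n) \<circ> (f ^^ n) = f ^^ n"
proof -
  have "finite (range (\<lambda>i. f ^^ i))"
    by (rule finite_subset[of _ UNIV]) (simp_all add: finite_UNIV_fun assms)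
  then have "\<not> inj (\<lambda>i::nat. f ^^ i)"
    using finite_imageD infinite_UNIV_nat by blast
  then obtain i j :: nat where ij: "i < j" "f ^^ i = f ^^ j"
    by (metis (mono_tags) injI linorder_neqE_nat)
  define p where "p = j - i"
  have period: "f ^^ (k + p) = f ^^ k" if "i \<le> k" for k
  proof -
    have "f ^^ (k + p) = f ^^ ((k - i) + j)"
      using that ij(1) by (simp add: p_def)
    also have "\<dots> = f ^^ ((k - i) + i)"
      by (simp only: funpow_add ij(2))
    finally show ?thesis
      using that by simp
  qed
  have periods: "f ^^ (k + m * p) = f ^^ k" if "i \<le> k" for k m
  proof (induction m)
    case (Suc m)
    have "f ^^ (k + Suc m * p) = f ^^ ((k + m * p) + p)"
      by (simp add: ac_simps)
    then show ?case
      using Suc period[of "k + m * p"] that by simp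
  qed simp
  have "p > 0"
    using ij(1) by (simp add: p_def)
  then have "i \<le> Suc i * p"
    by (cases p) auto
  then have "f ^^ (Suc i * p + Suc i * p) = f ^^ (Suc i * p)"
    by (rule periods)
  then have "(f ^^ (Suc i * p)) \<circ> (f ^^ (Suc i * p)) = f ^^ (Suc i * p)"
    by (simp only: funpow_add)
  with \<open>p > 0\<close> show ?thesis
    by (intro exI[of _ "Suc i * p"]) simp
qed

section \<open>The Fitting decomposition\<close>

lemma orthogonal_direct_sum_idempotent:
  assumes herm: "hermitian_form q s h" and "q > 0"
    and lin: "Vector_Spaces.linear s s e"
    and idem: "\<And>x. e (e x) = e x"
    and adj: "\<And>u v. h (e u) v = h u (e v)"
  shows "orthogonal_direct_sum s h (range e) {x. e x = 0}"
proof -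
  interpret e: Vector_Spaces.linear s s e by (rule lin)
  have "x = e x + (x - e x) \<and> e (x - e x) = 0" for x
    by (simp add: e.diff idem)
  then have "x \<in> {x + y |x y. x \<in> range e \<and> y \<in> {x. e x = 0}}" for x
    by blast
  then show ?thesis
    unfolding orthogonal_direct_sum_def
    using e.subspace_image[OF e.vs1.subspace_UNIV] e.subspace_kernel idem
    by (auto simp: adj hermitian_form_zero_right[OF herm \<open>q > 0\<close>] e.zero
             intro: range_eqI[of _ _ 0])
qed

text \<open>On the range of the idempotent \<open>N\<^sup>n\<close> the map \<open>N\<close> has the two-sided inverse \<open>N\<^sup>n\<^sup>-\<^sup>1\<close>.\<close>

lemma fitting_range_bij:
  assumes "n > 0" and idem: "\<And>x. (N ^^ n) ((N ^^ n) x) = (N ^^ n) x"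
  shows "bij_betw N (range (N ^^ n)) (range (N ^^ n))"
proof (rule bij_betw_byWitness[where f' = "N ^^ (n - 1)"])
  obtain k where k: "n = Suc k"
    using \<open>n > 0\<close> by (cases n) auto
  show "\<forall>x\<in>range (N ^^ n). (N ^^ (n - 1)) (N x) = x"
    using idem by (auto simp: k funpow_swap1)
  show "\<forall>x\<in>range (N ^^ n). N ((N ^^ (n - 1)) x) = x"
    using idem by (auto simp: k)
  show "N ` range (N ^^ n) \<subseteq> range (N ^^ n)"
    by (auto simp: funpow_swap1)
  have "(N ^^ (n - 1)) ((N ^^ n) x) = (N ^^ n) ((N ^^ (n - 1)) x)" for x
    by (metis add.commute comp_apply funpow_add)
  then show "(N ^^ (n - 1)) ` range (N ^^ n) \<subseteq> range (N ^^ n)"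
    by auto
qed

lemma fitting_kernel_nilpotent:
  assumes lin: "Vector_Spaces.linear s s N"
  shows "nilpotent_on N {x. (N ^^ n) x = 0}"
proof -
  interpret Vector_Spaces.linear s s N by (rule lin)
  show ?thesis
    unfolding nilpotent_on_def
    by (auto simp: funpow_swap1[symmetric])
qed

text \<open>\<open>U0 = N\<^sup>n U0\<close> lies in the range. On \<open>U1\<close> all high powers of \<open>N\<close> vanish, and the idempotent
  \<open>N\<^sup>n\<close> is itself such a high power, so \<open>U1\<close> lies in the kernel. Splitting an arbitrary vector
  along the given decomposition turns both inclusions into equalities.\<close>

lemma fitting_decomposition_unique:
  assumes lin: "Vector_Spaces.linear s s N"
    and "n > 0" and idem: "(N ^^ n) \<circ> (N ^^ n) = N ^^ n"
    and sum: "{x + y |x y. x \<in> U0 \<and> y \<in> U1} = UNIV"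
    and surj: "N ` U0 = U0" and nil: "nilpotent_on N U1"
  shows "U0 = range (N ^^ n)" and "U1 = {x. (N ^^ n) x = 0}"
proof -
  let ?e = "N ^^ n"
  interpret e: Vector_Spaces.linear s s ?e by (rule funpow_linear[OF lin])
  have U0: "?e ` U0 = U0"
    by (rule funpow_image_invariant[OF surj])
  have U1: "?e y = 0" if "y \<in> U1" for y
  proof -
    obtain m where "\<forall>u\<in>U1. (N ^^ m) u = 0"
      using nil by (auto simp: nilpotent_on_def)
    with that have m: "(N ^^ m) y = 0"
      by simp
    interpret k: Vector_Spaces.linear s s "N ^^ (n * Suc m - m)"
      by (rule funpow_linear[OF lin])
    have "m \<le> n * Suc m"
      using \<open>n > 0\<close> by (cases n) auto
    then have "?e = N ^^ ((n * Suc m - m) + m)"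
      using idempotent_funpow_mult[OF idem, of "Suc m"] by simp
    then have "?e y = (N ^^ (n * Suc m - m)) 0"
      using m by (simp only: funpow_add o_apply)
    then show ?thesis
      by (simp only: k.zero)
  qed
  have split: "\<exists>x y. z = x + y \<and> x \<in> U0 \<and> y \<in> U1" for z
    using sum by blast
  have "?e z \<in> U0" for z
    using split[of z] U0 U1 by (fastforce simp: e.add)
  then show "U0 = range ?e"
    using U0 by blast
  have "z \<in> U1" if "?e z = 0" for z
  proof -
    obtain x y where z: "z = x + y" "x \<in> U0" "y \<in> U1"
      using split by blast
    have "?e x = x"
      using z(2) U0 fun_cong[OF idem] by (metis comp_apply imageE)
    moreover have "?e x = 0"
      using that z U1 by (simp add: e.add)
    ultimately show ?thesis
      using z by simp
  qed
  then show "U1 = {x. ?e x = 0}"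
    using U1 by blast
qed

text \<open>Nilpotency passes from one composite of two maps to the other, at the cost of one more
  iteration: \<open>(T R)\<^sup>n\<^sup>+\<^sup>1 = T (R T)\<^sup>n R\<close>.\<close>

lemma nilpotent_on_comp_swap:
  assumes nil: "nilpotent_on (R \<circ> T) U" and "T 0 = 0"
    and "T ` U \<subseteq> U'" and "R ` U' \<subseteq> U"
  shows "nilpotent_on (T \<circ> R) U'"
proof -
  obtain n where n: "\<forall>u\<in>U. ((R \<circ> T) ^^ n) u = 0"
    using nil by (auto simp: nilpotent_on_def)
  have "((T \<circ> R) ^^ Suc n) w = 0" if "w \<in> U'" for w
  proof -
    have "((T \<circ> R) ^^ Suc n) w = T (((R \<circ> T) ^^ n) (R w))"
      by (simp add: funpow_comp_intertwine funpow_swap1[of "T \<circ> R", simplified])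
    then show ?thesis
      using n that assms(2,4) by (simp add: image_subset_iff)
  qed
  moreover have "(T \<circ> R) ` U' \<subseteq> U'"
    using assms(3,4) by (auto simp: image_subset_iff)
  ultimately show ?thesis
    unfolding nilpotent_on_def by (intro conjI exI[of _ "Suc n"] ballI)
qed

lemma fitting_range_image_subset:
  "T ` range ((R \<circ> T) ^^ n) \<subseteq> range ((T \<circ> R) ^^ n)"
  unfolding image_subset_iff using funpow_comp_intertwine[where S = T and R = R] by fast

lemma fitting_kernel_image_subset:
  assumes "T 0 = 0"
  shows "T ` {x. ((R \<circ> T) ^^ n) x = 0} \<subseteq> {y. ((T \<circ> R) ^^ n) y = 0}"
  using assms by (auto simp flip: funpow_comp_intertwine)

text \<open>The reverse inclusion holds because the range of the idempotent \<open>(T R)\<^sup>n\<close> is its own image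
  under \<open>T R\<close>, and \<open>R\<close> sends it into the range of \<open>(R T)\<^sup>n\<close>.\<close>

lemma fitting_range_image:
  assumes "n > 0"
    and idem: "\<And>y. ((T \<circ> R) ^^ n) (((T \<circ> R) ^^ n) y) = ((T \<circ> R) ^^ n) y"
  shows "T ` range ((R \<circ> T) ^^ n) = range ((T \<circ> R) ^^ n)"
proof
  have "range ((T \<circ> R) ^^ n) = T ` R ` range ((T \<circ> R) ^^ n)"
    using bij_betw_imp_surj_on[OF fitting_range_bij[OF \<open>n > 0\<close> idem]] by (simp add: image_comp)
  also have "\<dots> \<subseteq> T ` range ((R \<circ> T) ^^ n)"
    by (intro image_mono fitting_range_image_subset)
  finally show "range ((T \<circ> R) ^^ n) \<subseteq> T ` range ((R \<circ> T) ^^ n)" .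
qed (rule fitting_range_image_subset)

section \<open>The decomposition theorem\<close>

theorem theorem1p1:
  fixes q :: nat
    and sV :: "'f::field \<Rightarrow> 'v::ab_group_add \<Rightarrow> 'v"
    and sW :: "'f \<Rightarrow> 'w::ab_group_add \<Rightarrow> 'w"
    and hV :: "'v \<Rightarrow> 'v \<Rightarrow> 'f" and hW :: "'w \<Rightarrow> 'w \<Rightarrow> 'f"
    and T :: "'v \<Rightarrow> 'w" and Tadj :: "'w \<Rightarrow> 'v"
  assumes "primepow q" and "CARD('f) = q\<^sup>2"
    and "\<exists>B. finite_dimensional_vector_space sV B"
    and "\<exists>B. finite_dimensional_vector_space sW B"
    and "hermitian_form q sV hV" and "nondegenerate_form hV"
    and "hermitian_form q sW hW" and "nondegenerate_form hW"
    and "Vector_Spaces.linear sV sW T"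
  defines "Tadj \<equiv> form_adjoint sV hV sW hW T"
  shows "\<exists>!(V0, V1, W0, W1).
      orthogonal_direct_sum sV hV V0 V1 \<and> orthogonal_direct_sum sW hW W0 W1 \<and>
      (vector_space.dim sV V0 = vector_space.dim sW W0 \<and>
       T ` V0 = W0 \<and> Tadj ` W0 = V0 \<and> bij_betw (Tadj \<circ> T) V0 V0) \<and>
      (T ` V1 \<subseteq> W1 \<and> Tadj ` W1 \<subseteq> V1 \<and> nilpotent_on (Tadj \<circ> T) V1)"
proof -
  obtain B where fdV: "finite_dimensional_vector_space sV B"
    using assms(3) by blast
  obtain C where fdW: "finite_dimensional_vector_space sW C"
    using assms(4) by blast
  note V = assms(5,6) and W = assms(7,8) and T = assms(9)
  note adjoint = form_adjoint_linear_adjoint[OF assms(1,2) fdV V W(1) T, folded Tadj_def]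
  interpret pair: finite_dimensional_vector_space_pair sV B sW C
    by (intro finite_dimensional_vector_space_pair.intro fdV fdW)
  interpret T: Vector_Spaces.linear sV sW T by (rule T)
  interpret R: Vector_Spaces.linear sW sV Tadj by (rule adjoint(1))
  have "q > 0"
    using assms(1) by (rule primepow_gt_0_nat)
  have finF: "finite (UNIV :: 'f set)"
    using assms(2) \<open>q > 0\<close> by (intro card_ge_0_finite) simp

  let ?N = "Tadj \<circ> T" and ?M = "T \<circ> Tadj"
  have linN: "Vector_Spaces.linear sV sV ?N"
    by (rule Vector_Spaces.linear_compose[OF T adjoint(1)])
  have linM: "Vector_Spaces.linear sW sW ?M"
    by (rule Vector_Spaces.linear_compose[OF adjoint(1) T])
  have adjoint': "hW w (T v) = hV (Tadj w) v" for v w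
    using hermitian_form_conj[OF V(1)] hermitian_form_conj[OF W(1)] adjoint(2) by metis
  have selfN: "hV (?N u) v = hV u (?N v)" for u v
    by (simp flip: adjoint(2) adjoint')
  have selfM: "hW (?M u) v = hW u (?M v)" for u v
    by (simp add: adjoint(2) adjoint')

  obtain a where a: "a > 0" "(?N ^^ a) \<circ> (?N ^^ a) = ?N ^^ a"
    using idempotent_funpow_exists nondegenerate_hermitian_represents(1)[OF V(1) finF fdV V(2)]
    by blast
  obtain b where b: "b > 0" "(?M ^^ b) \<circ> (?M ^^ b) = ?M ^^ b"
    using idempotent_funpow_exists nondegenerate_hermitian_represents(1)[OF W(1) finF fdW W(2)]
    by blast
  \<comment> \<open>A common exponent is needed for the intertwining of the two idempotents.\<close>
  define n where "n = a * b"
  have "n > 0"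
    using a b by (simp add: n_def)
  have idemN: "(?N ^^ n) \<circ> (?N ^^ n) = ?N ^^ n"
    using idempotent_funpow_mult[OF a(2) b(1)] a(2) by (simp only: n_def)
  have idemM: "(?M ^^ n) \<circ> (?M ^^ n) = ?M ^^ n"
    using idempotent_funpow_mult[OF b(2) a(1)] b(2) by (simp only: n_def mult.commute)
  note idemN' = fun_cong[OF idemN, unfolded o_apply[of "?N ^^ n"]]
  note idemM' = fun_cong[OF idemM, unfolded o_apply[of "?M ^^ n"]]

  define V0 V1 W0 W1 where defs: "V0 = range (?N ^^ n)" "V1 = {x. (?N ^^ n) x = 0}"
    "W0 = range (?M ^^ n)" "W1 = {x. (?M ^^ n) x = 0}"
  have odsV: "orthogonal_direct_sum sV hV V0 V1"
    unfolding defs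
    by (intro orthogonal_direct_sum_idempotent[OF V(1) \<open>q > 0\<close>] funpow_linear linN idemN'
          funpow_self_adjoint selfN)
  have odsW: "orthogonal_direct_sum sW hW W0 W1"
    unfolding defs
    by (intro orthogonal_direct_sum_idempotent[OF W(1) \<open>q > 0\<close>] funpow_linear linM idemM'
          funpow_self_adjoint selfM)
  have TV0: "T ` V0 = W0"
    unfolding defs by (rule fitting_range_image[OF \<open>n > 0\<close> idemM'])
  have RW0: "Tadj ` W0 = V0"
    unfolding defs by (rule fitting_range_image[OF \<open>n > 0\<close> idemN'])
  have bij: "bij_betw ?N V0 V0"
    unfolding defs by (rule fitting_range_bij[OF \<open>n > 0\<close> idemN'])
  have "inj_on T V0"
    using bij by (metis bij_betw_imp_inj_on inj_on_imageI2)
  moreover have "module.subspace sV V0"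
    using odsV by (simp add: orthogonal_direct_sum_def)
  ultimately have "pair.vs2.dim (T ` V0) = pair.vs1.dim V0"
    by (intro pair.dim_image_eq[OF T]) (metis pair.vs1.span_eq_iff)
  then have dim: "pair.vs1.dim V0 = pair.vs2.dim W0"
    by (simp add: TV0)
  have TV1: "T ` V1 \<subseteq> W1" and RW1: "Tadj ` W1 \<subseteq> V1"
    unfolding defs by (rule fitting_kernel_image_subset, rule T.zero R.zero)+
  have nil: "nilpotent_on ?N V1"
    unfolding defs by (rule fitting_kernel_nilpotent[OF linN])

  have unique: "U0 = V0 \<and> U1 = V1 \<and> X0 = W0 \<and> X1 = W1"
    if odsU: "orthogonal_direct_sum sV hV U0 U1" and odsX: "orthogonal_direct_sum sW hW X0 X1"
      and im: "T ` U0 = X0" "Tadj ` X0 = U0" and sub: "T ` U1 \<subseteq> X1" "Tadj ` X1 \<subseteq> U1"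
      and nilU: "nilpotent_on ?N U1" for U0 U1 X0 X1
  proof -
    have "?N ` U0 = U0" "?M ` X0 = X0"
      using im by (simp_all only: image_comp[symmetric])
    moreover have "nilpotent_on ?M X1"
      by (rule nilpotent_on_comp_swap[OF nilU T.zero sub])
    ultimately show ?thesis
      unfolding defs using odsU odsX nilU
        fitting_decomposition_unique[OF linN \<open>n > 0\<close> idemN, of U0 U1]
        fitting_decomposition_unique[OF linM \<open>n > 0\<close> idemM, of X0 X1]
      unfolding orthogonal_direct_sum_def by blast
  qed
  show ?thesis (is "\<exists>!Z. ?P Z")
  proof (rule ex1I[of _ "(V0, V1, W0, W1)"])
    show "?P (V0, V1, W0, W1)"
      unfolding prod.case by (intro conjI odsV odsW dim TV0 RW0 bij TV1 RW1 nil)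
  next
    fix Z assume P: "?P Z"
    obtain U0 U1 X0 X1 where Z: "Z = (U0, U1, X0, X1)"
      by (cases Z)
    show "Z = (V0, V1, W0, W1)"
      using P unique[of U0 U1 X0 X1] unfolding Z prod.case by blast
  qed
qed

end
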